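(* Let $p$ and $q$ be relatively prime integers with $q\ge 1$, $\theta=p/q$, and let $\lambda>0$ be real. Let $z_1,z_2$ be complex numbers of modulus $1$. Then the coefficient of $x^0$ in the polynomial $\det(xI_q-h_{\theta,\lambda}(z_1,z_2))$ in $x$ is $$-\Big(z_1^q+z_1^{-q}+(\lambda/2)^q(z_2^q+z_2^{-q})\Big)+(-1)^{q/2}\,2\,\big(1+(\lambda/2)^q\big)$$ when $q$ is even, and is $$-\Big(z_1^q+z_1^{-q}+(\lambda/2)^q(z_2^q+z_2^{-q})\Big)$$ when $q$ is odd.
   Context: Let $\rho=e^{2\pi i\theta}$ with $\theta=p/q$. Let $u_\theta$ be the $q\times q$ cyclic permutation matrix with entries $1$ in positions $(j,j+1)$, $1\le j\le q-1$, and in position $(q,1)$, and $0$ elsewhere (so for $q=1$, $u_\theta=(1)$). Let $v_\theta=\mathrm{diag}(\rho,\rho^2,\dots,\rho^{q-1},1)$. For $z_1,z_2$ in the unit circle put $u(z_1,z_2)=z_1u_\theta$ and $v(z_1,z_2)=z_2v_\theta$, and define the $q\times q$ matrix $$h_{\theta,\lambda}(z_1,z_2)=u(z_1,z_2)+u(z_1,z_2)^{-1}+\tfrac{\lambda}{2}\big(v(z_1,z_2)+v(z_1,z_2)^{-1}\big).$$ $I_q$ is the $q\times q$ identity matrix. *)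

theory Defs
  imports
    Complex_Main
    "Jordan_Normal_Form.Gauss_Jordan_Elimination"
    "Jordan_Normal_Form.Char_Poly"
begin

text \<open>
  Since the size \<open>q\<close> is a natural number occurring in the statement, matrices are those of
  \<open>Jordan_Normal_Form\<close>, whose rows and columns are indexed from 0: the entry in position
  \<open>(j, k)\<close> of the mathematical text is the entry \<open>(j - 1, k - 1)\<close> here.
\<close>

definition theta :: "int \<Rightarrow> nat \<Rightarrow> real" where
  "theta p q = real_of_int p / real q"

definition rho :: "int \<Rightarrow> nat \<Rightarrow> complex" where
  "rho p q = exp (2 * complex_of_real pi * \<i> * complex_of_real (theta p q))"

definition u_theta :: "nat \<Rightarrow> complex mat" where
  "u_theta q = mat q q (\<lambda>(i, j). if j = Suc i \<or> Suc i = q \<and> j = 0 then 1 else 0)"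

definition v_theta :: "int \<Rightarrow> nat \<Rightarrow> complex mat" where
  "v_theta p q = mat_diag q (\<lambda>i. if Suc i = q then 1 else rho p q ^ Suc i)"

definition u_mat :: "nat \<Rightarrow> complex \<Rightarrow> complex mat" where
  "u_mat q z\<^sub>1 = z\<^sub>1 \<cdot>\<^sub>m u_theta q"

definition v_mat :: "int \<Rightarrow> nat \<Rightarrow> complex \<Rightarrow> complex mat" where
  "v_mat p q z\<^sub>2 = z\<^sub>2 \<cdot>\<^sub>m v_theta p q"

text \<open>
  The library's \<open>mat_inverse\<close> returns an option. It is \<open>Some\<close> of the two-sided inverse in
  both places where it is used below, see \<open>mat_inverse_u_mat\<close> and \<open>mat_inverse_v_mat\<close>.
\<close>

definition h_mat :: "int \<Rightarrow> nat \<Rightarrow> real \<Rightarrow> complex \<Rightarrow> complex \<Rightarrow> complex mat" where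
  "h_mat p q lam z\<^sub>1 z\<^sub>2 =
     u_mat q z\<^sub>1 + the (mat_inverse (u_mat q z\<^sub>1))
     + complex_of_real (lam / 2) \<cdot>\<^sub>m (v_mat p q z\<^sub>2 + the (mat_inverse (v_mat p q z\<^sub>2)))"

lemma mat_inverse_eq_SomeI:
  fixes A B :: "'a :: field mat"
  assumes A: "A \<in> carrier_mat n n" and B: "B \<in> carrier_mat n n" and AB: "A * B = 1\<^sub>m n"
  shows "mat_inverse A = Some B"
proof (cases "mat_inverse A")
  case None
  have "B * A = 1\<^sub>m n"
    using mat_mult_left_right_inverse[OF A B AB] .
  then have "A \<in> Units (ring_mat TYPE('a) n ())"
    using A B AB by (auto simp: Units_def ring_mat_simps)
  then show ?thesis
    using mat_inverse(1)[OF A None, of "()"] by blast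
next
  case (Some C)
  then have C: "C * A = 1\<^sub>m n" "C \<in> carrier_mat n n"
    using mat_inverse(2)[OF A] by auto
  have "C = C * (A * B)"
    using AB C by simp
  also have "\<dots> = C * A * B"
    using assoc_mult_mat[OF C(2) A B] by simp
  also have "\<dots> = B"
    using C B by simp
  finally show ?thesis
    using Some by simp
qed

lemma mat_inverse_u_mat:
  assumes "z\<^sub>1 \<noteq> 0"
  shows "mat_inverse (u_mat q z\<^sub>1) = Some (inverse z\<^sub>1 \<cdot>\<^sub>m transpose_mat (u_theta q))"
proof (rule mat_inverse_eq_SomeI[of _ q])
  let ?s = "\<lambda>i. if Suc i = q then 0 else Suc i"
  have U: "u_theta q = mat q q (\<lambda>(i, j). if j = ?s i then 1 else 0)"
    by (rule eq_matI) (auto simp: u_theta_def)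
  have "u_theta q * transpose_mat (u_theta q) = 1\<^sub>m q" (is "?L = _")
  proof (rule eq_matI)
    fix i j assume "i < dim_row (1\<^sub>m q :: complex mat)" "j < dim_col (1\<^sub>m q :: complex mat)"
    then have ij: "i < q" "j < q" by auto
    then have "?L $$ (i, j)
        = (\<Sum>k = 0..<q. (if k = ?s i then 1 else 0) * (if k = ?s j then 1 else 0))"
      by (simp add: U scalar_prod_def)
    also have "\<dots> = (\<Sum>k = 0..<q. if k = ?s i then (if ?s i = ?s j then 1 else 0) else 0)"
      by (rule sum.cong) auto
    also have "\<dots> = (if ?s i = ?s j then 1 else 0)"
      using ij by (subst sum.delta) auto
    finally show "?L $$ (i, j) = 1\<^sub>m q $$ (i, j)"
      using ij by (auto split: if_splits)
  qed (auto simp: u_theta_def)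
  moreover have "u_theta q \<in> carrier_mat q q"
    by (simp add: u_theta_def)
  ultimately show "u_mat q z\<^sub>1 * (inverse z\<^sub>1 \<cdot>\<^sub>m transpose_mat (u_theta q)) = 1\<^sub>m q"
    using assms by (auto simp: u_mat_def mult_smult_assoc_mat[of _ q q _ q]
        mult_smult_distrib[of _ q q _ q] intro!: eq_matI)
qed (auto simp: u_mat_def u_theta_def)

lemma mat_inverse_v_mat:
  assumes "z\<^sub>2 \<noteq> 0"
  shows "mat_inverse (v_mat p q z\<^sub>2) =
    Some (inverse z\<^sub>2 \<cdot>\<^sub>m mat_diag q (\<lambda>i. inverse (if Suc i = q then 1 else rho p q ^ Suc i)))"
    (is "_ = Some (_ \<cdot>\<^sub>m ?D)")
proof (rule mat_inverse_eq_SomeI[of _ q])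
  have "v_theta p q * ?D = 1\<^sub>m q"
    unfolding v_theta_def mat_diag_diag by (rule eq_matI) (auto simp: mat_diag_def rho_def)
  moreover have "v_theta p q \<in> carrier_mat q q" "?D \<in> carrier_mat q q"
    by (simp_all add: v_theta_def)
  ultimately show "v_mat p q z\<^sub>2 * (inverse z\<^sub>2 \<cdot>\<^sub>m ?D) = 1\<^sub>m q"
    using assms by (auto simp: v_mat_def mult_smult_assoc_mat[of _ q q _ q]
        mult_smult_distrib[of _ q q _ q] intro!: eq_matI)
qed (auto simp: v_mat_def v_theta_def)

end

theory Submission
  imports Defs
begin

text \<open>
  The constant coefficient of the characteristic polynomial is \<open>(- 1) ^ q * det H\<close> with
  \<open>H = h_mat p q lam z\<^sub>1 z\<^sub>2\<close>. Write \<open>r = rho p q\<close>, a primitive \<open>q\<close>-th root of unity since \<open>p\<close> and \<open>q\<close> are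
  coprime, and \<open>\<mu> = lam / 2\<close>. The idea is a change of basis in which both \<open>u\<close> and \<open>v\<close> become
  weighted cyclic shifts, so that \<open>H\<close> couples each index only to its two neighbours on a cycle
  of length \<open>q\<close>.

  The basis consists of the chirps \<open>w\<^sub>k(j) = r ^ (k * j) * s ^ j\<^sup>2\<close> with \<open>s\<^sup>2 = r\<close>. Multiplication by
  \<open>r ^ j\<close> sends \<open>w\<^sub>k\<close> to \<open>w\<^bsub>k+1\<^esub>\<close>, and because the exponent \<open>j\<^sup>2\<close> is quadratic the translation
  \<open>j \<mapsto> j + 1\<close> sends \<open>w\<^sub>k\<close> to a multiple of \<open>w\<^bsub>k+1\<^esub>\<close> too. Hence (\<open>h_mat_chirp\<close>)
  \<open>H w\<^bsub>k+1\<^esub> = a\<^bsub>k+1\<^esub> w\<^bsub>k+2\<^esub> + b\<^sub>k w\<^sub>k\<close> with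
  \<open>a\<^sub>k = z\<^sub>1 s r ^ k + \<mu> z\<^sub>2 r\<close> and \<open>b\<^sub>k = (z\<^sub>1 s r ^ k)\<^sup>-\<^sup>1 + \<mu> (z\<^sub>2 r)\<^sup>-\<^sup>1\<close>.

  The determinant becomes elementary after one more shift of the index. With
  \<open>R = diag (r ^ j)\<close>, which sends \<open>w\<^sub>k\<close> to \<open>w\<^bsub>k+1\<^esub>\<close>, the operator \<open>H R\<close> sends \<open>w\<^sub>k\<close> to \<open>b\<^sub>k w\<^sub>k + a\<^bsub>k+1\<^esub> w\<^bsub>k+2\<^esub>\<close>: a diagonal part plus a weighted
  step by two (\<open>det_h_mat_two_term\<close>). For odd \<open>q\<close> the step by two is a single \<open>q\<close>-cycle, for even
  \<open>q\<close> it splits into the even and the odd residues. On each cycle the matrix is a cyclic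
  bidiagonal matrix, whose determinant is the product of the diagonal weights plus or minus
  the product of the step weights (\<open>det_cyclic_bidiagonal\<close>). These products run over all powers
  of the primitive root \<open>r\<^sup>2\<close>, so \<open>prod_primitive_root\<close> evaluates them as \<open>y ^ n - (- x) ^ n\<close>. For odd
  \<open>q\<close> this is the asserted formula; for even \<open>q\<close> the two factors have the form \<open>A - B\<close> and
  \<open>A + B\<close>, and the mixed terms in \<open>z\<^sub>1\<close> and \<open>z\<^sub>2\<close> cancel in \<open>A\<^sup>2 - B\<^sup>2\<close>. The extra constant
  \<open>2 (1 + \<mu> ^ q)\<close> comes from the cross terms inside \<open>A\<^sup>2\<close> and \<open>B\<^sup>2\<close>.
\<close>

section \<open>Primitive roots of unity\<close>

definition primitive_root :: "nat \<Rightarrow> complex \<Rightarrow> bool" where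
  "primitive_root n w \<longleftrightarrow> (\<forall>k. w ^ k = 1 \<longleftrightarrow> n dvd k)"

lemma primitive_root_nonzero:
  assumes "primitive_root n w" "n \<ge> 1"
  shows "w \<noteq> 0"
proof
  assume "w = 0"
  moreover have "w ^ n = 1" using assms by (simp add: primitive_root_def)
  ultimately show False using assms(2) by (simp add: power_0_left)
qed

lemma primitive_root_power_eq_iff:
  assumes "primitive_root n w" "n \<ge> 1"
  shows "w ^ i = w ^ j \<longleftrightarrow> i mod n = j mod n"
proof -
  have w0: "w \<noteq> 0" using primitive_root_nonzero[OF assms] .
  have *: "w ^ i = w ^ j \<longleftrightarrow> i mod n = j mod n" if "i \<le> j" for i j
  proof -
    have "w ^ j = w ^ i * w ^ (j - i)" using that by (simp flip: power_add)
    then have "w ^ i = w ^ j \<longleftrightarrow> w ^ (j - i) = 1" using w0 by auto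
    also have "\<dots> \<longleftrightarrow> n dvd j - i" using assms by (simp add: primitive_root_def)
    also have "\<dots> \<longleftrightarrow> i mod n = j mod n" using mod_eq_dvd_iff_nat[OF that, of n] by auto
    finally show ?thesis .
  qed
  show ?thesis using *[of i j] *[of j i] by (cases "i \<le> j") auto
qed

lemma primitive_root_inverse:
  "primitive_root n w \<Longrightarrow> primitive_root n (inverse w)"
  by (simp add: primitive_root_def power_inverse)

text \<open>Squaring drops the order to its half exactly when the order is even; this is what makes
  the parity of \<open>q\<close> matter.\<close>
lemma primitive_root_square:
  assumes "primitive_root n w"
  shows "odd n \<Longrightarrow> primitive_root n (w\<^sup>2)" "n = 2 * m \<Longrightarrow> primitive_root m (w\<^sup>2)"
  using assms
  by (auto simp: primitive_root_def coprime_dvd_mult_right_iff simp flip: power_mult)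

lemma primitive_root_half:
  assumes "primitive_root (2 * m) w" "m \<ge> 1"
  shows "w ^ m = - 1"
proof -
  have "(w ^ m)\<^sup>2 = 1" "w ^ m \<noteq> 1"
    using assms by (auto simp: primitive_root_def mult.commute dest!: dvd_imp_le simp flip: power_mult)
  then show ?thesis by (auto simp: power2_eq_1_iff)
qed

text \<open>Homogenised form of \<open>\<Prod>(t - w ^ k) = t ^ n - 1\<close>: both sides are monic of degree \<open>n\<close>
  and agree at the \<open>n\<close> powers of \<open>w\<close>; then put \<open>t = - y / x\<close>.\<close>
lemma prod_primitive_root:
  assumes "primitive_root n w" "n \<ge> 1"
  shows "(\<Prod>k<n. x * w ^ k + y) = y ^ n - (- x) ^ n"
proof (cases "x = 0")
  case True
  then show ?thesis using assms by (simp add: power_0_left)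
next
  case False
  have inj: "inj_on (\<lambda>k. w ^ k) {..<n}"
    by (auto simp: inj_on_def primitive_root_power_eq_iff[OF assms])
  define P where "P = (\<Prod>k<n. [:- (w ^ k), 1:])"
  have deg: "degree P = n" unfolding P_def by (simp add: degree_prod_sum_eq)
  have "lead_coeff P = 1" unfolding P_def by (subst lead_coeff_prod) simp
  then have 1: "coeff P n = 1" by (simp add: deg)
  have 2: "coeff (monom 1 n - 1 :: complex poly) n = 1"
    using assms(2) by simp
  have 3: "degree (monom 1 n - 1 :: complex poly) \<le> n"
    by (rule degree_diff_le) (auto simp: degree_monom_le)
  have "P = monom 1 n - 1"
  proof (rule poly_eqI_degree_lead_coeff[where n = n and A = "(\<lambda>k. w ^ k) ` {..<n}"])
    fix z assume "z \<in> (\<lambda>k. w ^ k) ` {..<n}"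
    then obtain k where k: "k < n" "z = w ^ k" by auto
    then have "poly P z = 0" by (auto simp: P_def poly_prod)
    moreover have "z ^ n = 1"
      using assms k by (simp add: primitive_root_def flip: power_mult)
    ultimately show "poly P z = poly (monom 1 n - 1) z" by (simp add: poly_monom)
  qed (use 1 2 3 deg inj in \<open>auto simp: card_image\<close>)
  then have "poly P t = t ^ n - 1" for t by (simp add: poly_monom)
  then have P: "(\<Prod>k<n. t - w ^ k) = t ^ n - 1" for t by (simp add: P_def poly_prod)
  have "(\<Prod>k<n. x * w ^ k + y) = (\<Prod>k<n. (- x) * (- y / x - w ^ k))"
    by (rule prod.cong) (use False in \<open>auto simp: field_simps\<close>)
  also have "\<dots> = (- x) ^ n * ((- y / x) ^ n - 1)"
    unfolding prod.distrib P by simp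
  also have "\<dots> = (- x * (- y / x)) ^ n - (- x) ^ n"
    by (simp only: power_mult_distrib right_diff_distrib mult_1_right)
  finally show ?thesis using False by simp
qed

text \<open>The weights of the bidiagonal matrices below sit at exponents of one parity.\<close>
lemma prod_step_two:
  fixes r :: complex
  assumes "primitive_root n (r\<^sup>2)" "n \<ge> 1"
  shows "(\<Prod>k<n. x * r ^ (2 * k + d) + y) = y ^ n - (- (x * r ^ d)) ^ n"
    and "(\<Prod>k<n. inverse (x * r ^ (2 * k + d)) + y) = y ^ n - (- inverse (x * r ^ d)) ^ n"
proof -
  have e: "r ^ (2 * k + d) = (r\<^sup>2) ^ k * r ^ d" for k by (simp only: power_add power_mult)
  show "(\<Prod>k<n. x * r ^ (2 * k + d) + y) = y ^ n - (- (x * r ^ d)) ^ n"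
    unfolding prod_primitive_root[OF assms, symmetric] e
    by (simp only: mult.assoc mult.commute[of "r ^ d"])
  show "(\<Prod>k<n. inverse (x * r ^ (2 * k + d)) + y) = y ^ n - (- inverse (x * r ^ d)) ^ n"
    unfolding prod_primitive_root[OF primitive_root_inverse[OF assms(1)] assms(2), symmetric] e
    by (simp only: power_inverse inverse_mult_distrib mult.assoc mult.commute[of "inverse (r ^ d)"])
qed

lemma primitive_root_rho:
  assumes "coprime p (int q)" "q \<ge> 1"
  shows "primitive_root q (rho p q)"
  unfolding primitive_root_def
proof
  fix k
  have "rho p q = cis (2 * pi * theta p q)"
    unfolding rho_def cis_conv_exp by (simp add: ac_simps)
  then have "rho p q ^ k = cis (real k * (2 * pi * theta p q))"
    by (simp only: Complex.DeMoivre)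
  also have "\<dots> = 1 \<longleftrightarrow> cos (real k * (2 * pi * theta p q)) = 1"
    using cos_one_sin_zero by (auto simp: complex_eq_iff)
  also have "\<dots> \<longleftrightarrow> (\<exists>n::int. real k * (2 * pi * theta p q) = n * 2 * pi)"
    by (rule cos_one_2pi_int)
  also have "\<dots> \<longleftrightarrow> (\<exists>n::int. real_of_int (int k * p) = of_int (int q * n))"
    using assms(2) by (intro ex_cong1) (auto simp: theta_def field_simps)
  also have "\<dots> \<longleftrightarrow> int q dvd int k * p"
    unfolding of_int_eq_iff dvd_def ..
  also have "\<dots> \<longleftrightarrow> q dvd k"
    using assms(1) by (simp add: coprime_dvd_mult_left_iff coprime_commute)
  finally show "rho p q ^ k = 1 \<longleftrightarrow> q dvd k" .
qed

text \<open>The normalisation of \<open>s ^ q\<close> gives \<open>s ^ (q * q) = 1\<close> for both parities, which is what the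
  chirps need to be \<open>q\<close>-periodic. For even \<open>q\<close> either square root has it, because
  \<open>s ^ q = r ^ (q div 2) = - 1\<close>; for odd \<open>q\<close> the right one is a power of \<open>r\<close>.\<close>
lemma primitive_root_sqrt:
  assumes "primitive_root q r" "q \<ge> 1"
  obtains s where "s\<^sup>2 = r" "s ^ q = - ((- 1) ^ q)"
proof (cases "even q")
  case True
  then obtain m where m: "q = 2 * m" by blast
  have "(csqrt r) ^ q = r ^ m" by (simp add: m power_mult)
  also have "\<dots> = - 1" using primitive_root_half[of m r] assms by (simp add: m)
  finally show ?thesis using that[of "csqrt r"] True by simp
next
  case False
  then obtain m where m: "q = 2 * m + 1" by (elim oddE)
  have rq: "r ^ q = 1" using assms by (simp add: primitive_root_def)
  have "(r ^ (m + 1))\<^sup>2 = r ^ (q + 1)"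
    unfolding power_mult[symmetric] by (rule arg_cong[of _ _ "\<lambda>k. r ^ k"]) (simp add: m)
  also have "\<dots> = r" using rq by simp
  finally have 1: "(r ^ (m + 1))\<^sup>2 = r" .
  have "(r ^ (m + 1)) ^ q = (r ^ q) ^ (m + 1)" by (simp only: mult.commute flip: power_mult)
  then show ?thesis using that[OF 1] rq False by simp
qed

section \<open>Determinants\<close>

text \<open>The nodes being \<open>n\<close>-th roots of unity, the conjugate transpose (with the weights
  inverted) is an inverse up to the factor \<open>n\<close>, by orthogonality of characters.\<close>
lemma det_weighted_vandermonde_nonzero:
  fixes x :: "nat \<Rightarrow> complex"
  assumes g: "\<And>j. j < n \<Longrightarrow> g j \<noteq> 0" and x: "\<And>k. k < n \<Longrightarrow> x k ^ n = 1"
    and inj: "inj_on x {..<n}"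
  shows "det (mat n n (\<lambda>(j, k). x k ^ j * g j)) \<noteq> 0" (is "det ?W \<noteq> 0")
proof -
  let ?Z = "mat n n (\<lambda>(l, j). inverse (x l) ^ j / g j)"
  have "?Z * ?W = of_nat n \<cdot>\<^sub>m 1\<^sub>m n"
  proof (rule eq_matI)
    fix l k assume "l < dim_row (of_nat n \<cdot>\<^sub>m 1\<^sub>m n :: complex mat)"
      "k < dim_col (of_nat n \<cdot>\<^sub>m 1\<^sub>m n :: complex mat)"
    then have lk: "l < n" "k < n" by auto
    have x0: "x l \<noteq> 0" using x[OF lk(1)] lk by (auto simp: power_0_left)
    define t where "t = x k / x l"
    have "(?Z * ?W) $$ (l, k) = (\<Sum>j<n. t ^ j)"
      using lk g by (auto simp: scalar_prod_def t_def field_simps power_divide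
          simp flip: lessThan_atLeast0 intro!: sum.cong)
    also have "\<dots> = (if l = k then of_nat n else 0)"
    proof (cases "l = k")
      case True
      then show ?thesis using x0 by (simp add: t_def)
    next
      case False
      then have "t \<noteq> 1" using inj lk x0 by (auto simp: t_def inj_on_def)
      moreover have "t ^ n = 1" using x lk by (simp add: t_def power_divide)
      ultimately show ?thesis using False by (simp add: geometric_sum)
    qed
    finally show "(?Z * ?W) $$ (l, k) = (of_nat n \<cdot>\<^sub>m 1\<^sub>m n) $$ (l, k)"
      using lk by simp
  qed auto
  then have "det ?Z * det ?W = of_nat n ^ n"
    by (subst det_mult[symmetric, of _ n]) auto
  then show ?thesis by (cases "n = 0") auto
qed

text \<open>Column \<open>k\<close> encodes the image \<open>b k\<close> times the \<open>k\<close>-th plus \<open>a k\<close> times the \<open>\<pi> k\<close>-th basis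
  vector. The entries are added, so that a fixed point of \<open>\<pi>\<close>, which occurs for cycles of
  length 1, is covered.\<close>
definition two_term_mat :: "nat \<Rightarrow> (nat \<Rightarrow> nat) \<Rightarrow> (nat \<Rightarrow> 'a) \<Rightarrow> (nat \<Rightarrow> 'a) \<Rightarrow> 'a :: comm_ring_1 mat"
  where "two_term_mat n \<pi> b a =
    mat n n (\<lambda>(l, k). (if l = k then b k else 0) + (if l = \<pi> k then a k else 0))"

text \<open>The last column has only two nonzero entries, at the bottom and at the top. Deleting the
  one leaves a lower triangular matrix with diagonal \<open>b\<close>, deleting the other an upper triangular
  one with diagonal \<open>a\<close>.\<close>
lemma det_cyclic_bidiagonal:
  fixes a b :: "nat \<Rightarrow> 'a :: idom"
  assumes "n \<ge> 1"
  shows "det (two_term_mat n (\<lambda>k. Suc k mod n) b a) = (\<Prod>k<n. b k) - (- 1) ^ n * (\<Prod>k<n. a k)"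
proof (cases "n = 1")
  case True
  then show ?thesis by (subst det_single) (auto simp: two_term_mat_def)
next
  case False
  then obtain m where n: "n = Suc m" and m: "m \<ge> 1" using assms by (cases n) auto
  define T where "T = two_term_mat n (\<lambda>k. Suc k mod n) b a"
  have T: "T \<in> carrier_mat n n" by (simp add: T_def two_term_mat_def)
  have Tk: "T $$ (l, k) = (if l = k then b k else 0) + (if l = Suc k then a k else 0)"
    if "l < n" "k < m" for l k
    using that n by (simp add: T_def two_term_mat_def)
  have Tm: "T $$ (l, m) = (if l = m then b m else 0) + (if l = 0 then a m else 0)"
    if "l < n" for l
    using that n by (simp add: T_def two_term_mat_def)
  have lo: "det (mat_delete T m m) = (\<Prod>k<m. b k)"
  proof -
    have e: "mat_delete T m m = mat m m (\<lambda>(l, k). T $$ (l, k))"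
      using T n by (auto simp: mat_delete_def)
    show ?thesis unfolding e
      by (subst det_lower_triangular[of m])
        (use n in \<open>auto simp: Tk prod_list_diag_prod simp flip: lessThan_atLeast0 intro!: prod.cong\<close>)
  qed
  have up: "det (mat_delete T 0 m) = (\<Prod>k<m. a k)"
  proof -
    have e: "mat_delete T 0 m = mat m m (\<lambda>(l, k). T $$ (Suc l, k))"
      using T n by (auto simp: mat_delete_def)
    show ?thesis unfolding e
      by (subst det_upper_triangular[of _ m])
        (use n in \<open>auto simp: Tk prod_list_diag_prod upper_triangular_def
           simp flip: lessThan_atLeast0 intro!: prod.cong\<close>)
  qed
  have "det T = (\<Sum>l<n. T $$ (l, m) * cofactor T l m)"
    using laplace_expansion_column[OF T, of m] n by simp
  also have "\<dots> = (\<Sum>l\<in>{0, m}. T $$ (l, m) * cofactor T l m)"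
    by (rule sum.mono_neutral_right) (use n Tm in auto)
  also have "\<dots> = b m * (\<Prod>k<m. b k) + a m * ((- 1) ^ m * (\<Prod>k<m. a k))"
    using m n by (simp add: Tm cofactor_def lo up mult.commute[of "-1" 2] flip: mult_2)
  finally show ?thesis by (simp add: T_def n algebra_simps)
qed

text \<open>A permutation that consists of a cycle on \<open>{..<m}\<close> and one on \<open>{m..<2 * m}\<close> makes the matrix
  block diagonal.\<close>
lemma det_two_cyclic_bidiagonal:
  fixes a b :: "nat \<Rightarrow> 'a :: idom"
  assumes "m \<ge> 1"
  shows "det (two_term_mat (2 * m)
      (\<lambda>k. if k < m then Suc k mod m else m + Suc (k - m) mod m) b a) =
    ((\<Prod>k<m. b k) - (- 1) ^ m * (\<Prod>k<m. a k)) *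
    ((\<Prod>k<m. b (m + k)) - (- 1) ^ m * (\<Prod>k<m. a (m + k)))"
proof -
  have *: "Suc k mod m < m" for k using assms by simp
  have **: "l \<noteq> Suc k mod m" if "l \<ge> m" for k l using *[of k] that by simp
  have "two_term_mat (2 * m) (\<lambda>k. if k < m then Suc k mod m else m + Suc (k - m) mod m) b a =
    four_block_mat (two_term_mat m (\<lambda>k. Suc k mod m) b a) (0\<^sub>m m m) (0\<^sub>m m m)
      (two_term_mat m (\<lambda>k. Suc k mod m) (\<lambda>k. b (m + k)) (\<lambda>k. a (m + k)))"
    by (rule eq_matI) (auto simp: two_term_mat_def **)
  then show ?thesis
    by (simp add: det_four_block_mat_lower_left_zero[of _ m _ m] two_term_mat_def
        flip: det_cyclic_bidiagonal[OF assms])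
qed

section \<open>The operator in the basis of chirps\<close>

lemma h_mat_carrier:
  assumes "z\<^sub>1 \<noteq> 0" "z\<^sub>2 \<noteq> 0"
  shows "h_mat p q lam z\<^sub>1 z\<^sub>2 \<in> carrier_mat q q"
  using assms unfolding h_mat_def mat_inverse_u_mat[OF assms(1)] mat_inverse_v_mat[OF assms(2)]
  by (simp add: u_mat_def v_mat_def u_theta_def v_theta_def)

text \<open>The three contributions are added, since for \<open>q = 1\<close> and \<open>q = 2\<close> the positions coincide. The
  last diagonal entry 1 of \<open>v\<close> is the regular one, as \<open>rho p q ^ q = 1\<close>.\<close>
lemma h_mat_index:
  assumes "z\<^sub>1 \<noteq> 0" "z\<^sub>2 \<noteq> 0" "primitive_root q (rho p q)" "i < q" "j < q"
  shows "h_mat p q lam z\<^sub>1 z\<^sub>2 $$ (i, j) =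
    (if j = Suc i mod q then z\<^sub>1 else 0) + (if j = (i + q - 1) mod q then inverse z\<^sub>1 else 0)
    + (if j = i then complex_of_real (lam / 2) *
        (z\<^sub>2 * rho p q ^ Suc i + inverse (z\<^sub>2 * rho p q ^ Suc i)) else 0)"
proof -
  have succ: "(j = Suc i \<or> Suc i = q \<and> j = 0) \<longleftrightarrow> j = Suc i mod q" if "i < q" "j < q" for i j
    using that by (cases "Suc i = q") auto
  have pred: "(i = Suc j \<or> Suc j = q \<and> i = 0) \<longleftrightarrow> j = (i + q - 1) mod q"
    using assms(4,5) by (cases i) auto
  have last: "(if Suc i = q then 1 else rho p q ^ Suc i) = rho p q ^ Suc i"
    using assms(3) by (auto simp: primitive_root_def simp del: power_Suc)
  let ?v = "v_mat p q z\<^sub>2" and ?v' = "inverse z\<^sub>2 \<cdot>\<^sub>m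
    mat_diag q (\<lambda>i. inverse (if Suc i = q then 1 else rho p q ^ Suc i))"
  let ?u = "u_mat q z\<^sub>1" and ?u' = "inverse z\<^sub>1 \<cdot>\<^sub>m transpose_mat (u_theta q)"
  have carrier: "?u \<in> carrier_mat q q" "?u' \<in> carrier_mat q q"
    "?v \<in> carrier_mat q q" "?v' \<in> carrier_mat q q"
    by (simp_all add: u_mat_def u_theta_def v_mat_def v_theta_def)
  have "h_mat p q lam z\<^sub>1 z\<^sub>2 $$ (i, j) =
      ?u $$ (i, j) + ?u' $$ (i, j) + complex_of_real (lam / 2) * (?v $$ (i, j) + ?v' $$ (i, j))"
    unfolding h_mat_def mat_inverse_u_mat[OF assms(1)] mat_inverse_v_mat[OF assms(2)] option.sel
    using carrier[THEN carrier_matD(1)] carrier[THEN carrier_matD(2)] assms(4,5)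
    by (simp del: index_smult_mat(1) index_transpose_mat(1) add: index_smult_mat(1)[of _ "_ + _"])
  moreover have "u_mat q z\<^sub>1 $$ (i, j) = (if j = Suc i mod q then z\<^sub>1 else 0)"
    using assms(4,5) by (simp add: u_mat_def u_theta_def succ)
  moreover have "(inverse z\<^sub>1 \<cdot>\<^sub>m transpose_mat (u_theta q)) $$ (i, j) =
      (if j = (i + q - 1) mod q then inverse z\<^sub>1 else 0)"
    using assms(4,5) by (simp add: u_theta_def pred)
  moreover have "?v $$ (i, j) = (if j = i then z\<^sub>2 * rho p q ^ Suc i else 0)"
    using assms(4,5) last by (auto simp: v_mat_def v_theta_def mat_diag_def)
  moreover have "?v' $$ (i, j) = (if j = i then inverse (z\<^sub>2 * rho p q ^ Suc i) else 0)"
    using assms(4,5) by (subst last[symmetric]) (simp add: mat_diag_def)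
  ultimately show ?thesis by (simp del: index_smult_mat(1) power_Suc)
qed

definition chirp :: "complex \<Rightarrow> complex \<Rightarrow> nat \<Rightarrow> nat \<Rightarrow> complex" where
  "chirp r s k j = r ^ (k * j) * s ^ (j\<^sup>2)"

lemma chirp_modulate: "r ^ j * chirp r s k j = chirp r s (Suc k) j"
  by (simp add: chirp_def power_add algebra_simps)

lemma chirp_shift:
  assumes "s\<^sup>2 = r"
  shows "chirp r s k (Suc j) = s * r ^ k * chirp r s (Suc k) j"
proof -
  have "s ^ (Suc j)\<^sup>2 = s ^ j\<^sup>2 * (s\<^sup>2) ^ j * s"
    by (simp add: power2_eq_square algebra_simps flip: power_add power_mult)
  then show ?thesis
    by (simp add: chirp_def power_add algebra_simps assms)
qed

text \<open>Translation by 1 and multiplication by \<open>r ^ j\<close> both raise the index of a chirp by one, their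
  inverses lower it. Applied to index \<open>k + 1\<close>, the terms with \<open>u\<close> and \<open>v\<close> produce index \<open>k + 2\<close> and
  those with \<open>u\<^sup>-\<^sup>1\<close> and \<open>v\<^sup>-\<^sup>1\<close> index \<open>k\<close>.\<close>
lemma h_mat_chirp:
  assumes z: "z\<^sub>1 \<noteq> 0" "z\<^sub>2 \<noteq> 0" and r: "primitive_root q r" "r = rho p q"
    and s: "s\<^sup>2 = r" "s ^ q = - ((- 1) ^ q)" and i: "i < q"
  shows "(\<Sum>j<q. h_mat p q lam z\<^sub>1 z\<^sub>2 $$ (i, j) * chirp r s (Suc k) j) =
    (z\<^sub>1 * s * r ^ Suc k + complex_of_real (lam / 2) * (z\<^sub>2 * r)) * chirp r s (Suc (Suc k)) i
    + (inverse (z\<^sub>1 * s * r ^ k) + complex_of_real (lam / 2) * inverse (z\<^sub>2 * r)) * chirp r s k i"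
proof -
  define \<mu> where "\<mu> = complex_of_real (lam / 2)"
  define f where "f = chirp r s (Suc k)"
  have q: "q \<ge> 1" using i by simp
  have r0: "r \<noteq> 0" using primitive_root_nonzero[OF r(1) q] .
  then have s0: "s \<noteq> 0" using s(1) by auto
  have rq: "r ^ q = 1" using r(1) by (simp add: primitive_root_def)
  \<comment> \<open>The chirps have period \<open>q\<close>, so cyclic translation is the same as translation.\<close>
  have sq: "s ^ (q\<^sup>2) = 1"
    unfolding power2_eq_square power_mult s(2) by (cases "even q") auto
  have per: "chirp r s k q = chirp r s k 0" for k
    using rq sq by (simp add: chirp_def mult.commute[of k] power_mult)
  have per': "chirp r s k (Suc j mod q) = chirp r s k (Suc j)" if "j < q" for k j
    using that per[of k] by (cases "Suc j = q") auto
  let ?j = "(i + q - 1) mod q"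
  have j: "?j < q" "Suc ?j mod q = i" using i by (cases i; simp)+
  have "(\<Sum>j<q. h_mat p q lam z\<^sub>1 z\<^sub>2 $$ (i, j) * f j) =
    (\<Sum>j<q. (if j = Suc i mod q then z\<^sub>1 * f j else 0) + (if j = ?j then inverse z\<^sub>1 * f j else 0)
      + (if j = i then \<mu> * (z\<^sub>2 * r ^ Suc i + inverse (z\<^sub>2 * r ^ Suc i)) * f j else 0))"
    using i r by (intro sum.cong refl, subst h_mat_index[OF z]) (auto simp: algebra_simps \<mu>_def)
  also have "\<dots> = z\<^sub>1 * f (Suc i mod q) + inverse z\<^sub>1 * f ?j
      + \<mu> * (z\<^sub>2 * r ^ Suc i + inverse (z\<^sub>2 * r ^ Suc i)) * f i"
    using i q j(1) by (simp add: sum.distrib)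
  also have "f (Suc i mod q) = s * r ^ Suc k * chirp r s (Suc (Suc k)) i"
    unfolding f_def per'[OF i] by (rule chirp_shift[OF s(1)])
  also have "f ?j = inverse (s * r ^ k) * chirp r s k i"
  proof -
    have "chirp r s k i = s * r ^ k * f ?j"
      using per'[OF j(1), of k] chirp_shift[OF s(1), of k ?j] unfolding j(2) f_def by simp
    then show ?thesis using r0 s0 by (simp add: field_simps)
  qed
  also have "\<mu> * (z\<^sub>2 * r ^ Suc i + inverse (z\<^sub>2 * r ^ Suc i)) * f i =
     \<mu> * (z\<^sub>2 * r) * (r ^ i * f i) + \<mu> * inverse (z\<^sub>2 * r) * (inverse (r ^ i) * f i)"
    by (simp add: algebra_simps)
  also have "r ^ i * f i = chirp r s (Suc (Suc k)) i"
    unfolding f_def by (rule chirp_modulate)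
  also have "inverse (r ^ i) * f i = chirp r s k i"
    using r0 by (simp add: f_def flip: chirp_modulate)
  finally show ?thesis unfolding f_def \<mu>_def by (simp add: algebra_simps)
qed

text \<open>The map \<open>c\<close> enumerates the residues modulo \<open>q\<close> in an order that suits the step by two, and
  \<open>\<pi>\<close> is that step in terms of positions. With the chirps of index \<open>c k\<close> as the columns of \<open>W\<close>
  and \<open>R = diag (r ^ j)\<close>, the action of \<open>H\<close> reads \<open>H * (R * W) = W * T\<close>. The matrix \<open>W\<close> is a weighted
  Vandermonde matrix in distinct roots of unity and can be cancelled; the sign on the left is
  \<open>det R\<close>.\<close>
lemma det_h_mat_two_term:
  assumes z: "z\<^sub>1 \<noteq> 0" "z\<^sub>2 \<noteq> 0" and r: "primitive_root q r" "r = rho p q" and q: "q \<ge> 1"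
    and s: "s\<^sup>2 = r" "s ^ q = - ((- 1) ^ q)"
    and c: "inj_on (\<lambda>k. c k mod q) {..<q}"
    and \<pi>: "\<And>k. k < q \<Longrightarrow> \<pi> k < q" "\<And>k. k < q \<Longrightarrow> c (\<pi> k) mod q = (c k + 2) mod q"
  shows "- ((- 1) ^ q) * det (h_mat p q lam z\<^sub>1 z\<^sub>2) =
    det (two_term_mat q \<pi>
      (\<lambda>k. inverse (z\<^sub>1 * s * r ^ c k) + complex_of_real (lam / 2) * inverse (z\<^sub>2 * r))
      (\<lambda>k. z\<^sub>1 * s * r ^ Suc (c k) + complex_of_real (lam / 2) * (z\<^sub>2 * r)))"
    (is "_ = det (two_term_mat q \<pi> ?b ?a)")
proof -
  let ?H = "h_mat p q lam z\<^sub>1 z\<^sub>2"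
  let ?T = "two_term_mat q \<pi> ?b ?a"
  define R where "R = mat_diag q (\<lambda>j. r ^ j)"
  define W where "W = mat q q (\<lambda>(j, k). chirp r s (c k) j)"
  have H: "?H \<in> carrier_mat q q" using h_mat_carrier[OF z] .
  have W: "W \<in> carrier_mat q q" and R: "R \<in> carrier_mat q q" and T: "?T \<in> carrier_mat q q"
    by (simp_all add: W_def R_def two_term_mat_def)
  have rq: "r ^ q = 1" using r(1) by (simp add: primitive_root_def)
  have cyc: "chirp r s k i = chirp r s l i" if "k mod q = l mod q" for k l i
  proof -
    have "r ^ k = r ^ l" using that primitive_root_power_eq_iff[OF r(1) q] by simp
    then show ?thesis by (simp add: chirp_def power_mult)
  qed
  have RW: "R * W = mat q q (\<lambda>(j, k). chirp r s (Suc (c k)) j)"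
    unfolding R_def by (subst mat_diag_mult_left[OF W]) (auto simp: W_def chirp_modulate)
  have "?H * (R * W) = W * ?T"
  proof (rule eq_matI)
    fix i k assume "i < dim_row (W * ?T)" "k < dim_col (W * ?T)"
    then have ik: "i < q" "k < q" by (auto simp: W_def two_term_mat_def)
    have "(?H * (R * W)) $$ (i, k) = (\<Sum>j<q. ?H $$ (i, j) * chirp r s (Suc (c k)) j)"
      unfolding RW using ik H by (simp add: scalar_prod_def flip: lessThan_atLeast0)
    also have "\<dots> = ?a k * chirp r s (Suc (Suc (c k))) i + ?b k * chirp r s (c k) i"
      by (rule h_mat_chirp[OF z r s ik(1)])
    also have "chirp r s (Suc (Suc (c k))) i = chirp r s (c (\<pi> k)) i"
      by (rule cyc) (simp add: \<pi>(2)[OF ik(2)])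
    also have "?a k * chirp r s (c (\<pi> k)) i + ?b k * chirp r s (c k) i =
      (\<Sum>l<q. (if l = k then ?b k * chirp r s (c l) i else 0)
        + (if l = \<pi> k then ?a k * chirp r s (c l) i else 0))"
      using ik \<pi>(1) by (simp add: sum.distrib)
    also have "\<dots> = (W * ?T) $$ (i, k)"
      using ik by (auto simp: W_def two_term_mat_def scalar_prod_def algebra_simps
          simp flip: lessThan_atLeast0 intro!: sum.cong)
    finally show "(?H * (R * W)) $$ (i, k) = (W * ?T) $$ (i, k)" .
  qed (use H W T in auto)
  then have "det ?H * (det R * det W) = det W * det ?T"
    using det_mult[OF H, of "R * W"] det_mult[OF R W] det_mult[OF W T] R W by simp
  moreover have "det W \<noteq> 0"
  proof -
    have "s \<noteq> 0" using primitive_root_nonzero[OF r(1) q] s(1) by auto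
    moreover have "(r ^ c k) ^ q = 1" for k
      using power_mult[of r q "c k"] power_mult[of r "c k" q] rq by (simp add: mult.commute)
    ultimately have "det (mat q q (\<lambda>(j, k). (r ^ c k) ^ j * s ^ (j\<^sup>2))) \<noteq> 0"
    proof (intro det_weighted_vandermonde_nonzero)
      show "inj_on (\<lambda>k. r ^ c k) {..<q}"
        using c unfolding inj_on_def primitive_root_power_eq_iff[OF r(1) q] .
    qed auto
    then show ?thesis by (simp add: W_def chirp_def power_mult)
  qed
  moreover have "det R = - ((- 1) ^ q)"
  proof -
    \<comment> \<open>The case \<open>x = 1\<close>, \<open>y = 0\<close> of the product over all powers.\<close>
    have "det R = (\<Prod>k<q. 1 * r ^ k + 0)"
      unfolding R_def by (subst det_upper_triangular[of _ q])
        (auto simp: mat_diag_def prod_list_diag_prod upper_triangular_def simp flip: lessThan_atLeast0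
          intro!: prod.cong)
    then show ?thesis using prod_primitive_root[OF r(1) q, of 1 0] q by (simp add: power_0_left)
  qed
  ultimately have "det W * (- ((- 1) ^ q) * det ?H) = det W * det ?T" by (simp only: ac_simps)
  with \<open>det W \<noteq> 0\<close> show ?thesis by (rule mult_left_cancel[THEN iffD1])
qed

section \<open>The determinant for odd and for even size\<close>

text \<open>For odd \<open>q\<close> the order \<open>0, 2, 4, \<dots>\<close> runs through all residues modulo \<open>q\<close>, so there is a single
  cyclic bidiagonal matrix.\<close>
lemma det_h_mat_odd:
  assumes z: "z\<^sub>1 \<noteq> 0" "z\<^sub>2 \<noteq> 0" and "coprime p (int q)" and odd: "odd q"
  shows "det (h_mat p q lam z\<^sub>1 z\<^sub>2) =
    z\<^sub>1 ^ q + inverse z\<^sub>1 ^ q + complex_of_real (lam / 2) ^ q * (z\<^sub>2 ^ q + inverse z\<^sub>2 ^ q)"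
proof -
  define \<mu> where "\<mu> = complex_of_real (lam / 2)"
  define r where "r = rho p q"
  have q: "q \<ge> 1" using odd by (cases q) auto
  have r: "primitive_root q r" unfolding r_def by (rule primitive_root_rho) fact+
  obtain s where s: "s\<^sup>2 = r" "s ^ q = - ((- 1) ^ q)" using primitive_root_sqrt[OF r q] .
  have rq: "r ^ q = 1" and sq: "s ^ q = 1" using r s odd by (simp_all add: primitive_root_def)
  have r2: "primitive_root q (r\<^sup>2)" using primitive_root_square(1)[OF r odd] .
  have inj: "inj_on (\<lambda>k. 2 * k mod q) {..<q}"
    using primitive_root_power_eq_iff[OF r q] primitive_root_power_eq_iff[OF r2 q]
    by (auto simp: inj_on_def simp flip: power_mult)
  have "det (h_mat p q lam z\<^sub>1 z\<^sub>2) = det (two_term_mat q (\<lambda>k. Suc k mod q)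
      (\<lambda>k. inverse (z\<^sub>1 * s * r ^ (2 * k)) + \<mu> * inverse (z\<^sub>2 * r))
      (\<lambda>k. z\<^sub>1 * s * r ^ Suc (2 * k) + \<mu> * (z\<^sub>2 * r)))"
    using det_h_mat_two_term[OF z r r_def q s inj, of "\<lambda>k. Suc k mod q" lam] odd q
    by (simp add: \<mu>_def mod_mult_right_eq)
  also have "\<dots> = (\<Prod>k<q. inverse (z\<^sub>1 * s * r ^ (2 * k + 0)) + \<mu> * inverse (z\<^sub>2 * r))
      + (\<Prod>k<q. z\<^sub>1 * s * r ^ (2 * k + 1) + \<mu> * (z\<^sub>2 * r))"
    using odd by (simp add: det_cyclic_bidiagonal[OF q])
  also have "\<dots> = z\<^sub>1 ^ q + inverse z\<^sub>1 ^ q + \<mu> ^ q * (z\<^sub>2 ^ q + inverse z\<^sub>2 ^ q)"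
    unfolding prod_step_two[OF r2 q] using odd
    by (simp add: power_mult_distrib power_inverse rq sq algebra_simps)
  finally show ?thesis by (simp add: \<mu>_def)
qed

text \<open>For \<open>q = 2 * m\<close> the even residues are listed before the odd ones and there are two cyclic
  bidiagonal matrices of size \<open>m\<close>. Passing from one to the other multiplies \<open>z\<^sub>1 s\<close> by \<open>r\<close>, hence
  its \<open>m\<close>-th power by \<open>r ^ m = - 1\<close>: this sign between the two factors removes the terms that mix
  \<open>z\<^sub>1\<close> and \<open>z\<^sub>2\<close>.\<close>
lemma det_h_mat_even:
  assumes z: "z\<^sub>1 \<noteq> 0" "z\<^sub>2 \<noteq> 0" and "coprime p (int q)" and m: "q = 2 * m" "m \<ge> 1"
  shows "det (h_mat p q lam z\<^sub>1 z\<^sub>2) =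
    - (z\<^sub>1 ^ q + inverse z\<^sub>1 ^ q + complex_of_real (lam / 2) ^ q * (z\<^sub>2 ^ q + inverse z\<^sub>2 ^ q))
    + (- 1) ^ m * 2 * (1 + complex_of_real (lam / 2) ^ q)"
proof -
  define \<mu> where "\<mu> = complex_of_real (lam / 2)"
  define r where "r = rho p q"
  have q: "q \<ge> 1" using m by simp
  have r: "primitive_root q r" unfolding r_def by (rule primitive_root_rho) fact+
  obtain s where s: "s\<^sup>2 = r" "s ^ q = - ((- 1) ^ q)" using primitive_root_sqrt[OF r q] .
  have rm: "r ^ m = - 1" using primitive_root_half r m by simp
  have r2: "primitive_root m (r\<^sup>2)" using primitive_root_square(2)[OF r m(1)] .
  define c where "c = (\<lambda>k. if k < m then 2 * k else 2 * (k - m) + 1)"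
  define \<pi> where "\<pi> = (\<lambda>k. if k < m then Suc k mod m else m + Suc (k - m) mod m)"
  have c_lt: "c k < q" if "k < q" for k using that m by (auto simp: c_def)
  have "inj_on c {..<q}" by (auto simp: inj_on_def c_def split: if_splits; presburger)
  then have inj: "inj_on (\<lambda>k. c k mod q) {..<q}" using c_lt by (auto simp: inj_on_def)
  have \<pi>_lt: "\<pi> k < q" if "k < q" for k
    using m mod_less_divisor[of m "Suc k"] mod_less_divisor[of m "Suc (k - m)"]
    unfolding \<pi>_def by (simp split: if_split del: mod_less_divisor)
  have step: "c (\<pi> k) mod q = (c k + 2) mod q" if "k < q" for k
  proof (cases "k < m")
    case True
    then show ?thesis
      using m by (cases "Suc k = m") (auto simp: c_def \<pi>_def)
  next
    case False
    show ?thesis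
    proof (cases "Suc (k - m) = m")
      case True
      \<comment> \<open>The step from \<open>q - 1\<close> leads to \<open>q + 1\<close>, which is congruent to the first odd residue 1.\<close>
      then have "c k + 2 = q + 1" using False m by (simp add: c_def)
      moreover have "c (\<pi> k) = 1" using False True by (simp add: c_def \<pi>_def)
      ultimately show ?thesis by (simp only: mod_add_self1)
    next
      case neq: False
      then show ?thesis using False m that by (simp add: c_def \<pi>_def)
    qed
  qed
  define t where "t = s ^ m"
  have t2: "t * t = - 1" using s(2) m
    by (simp add: t_def power_mult power2_eq_square flip: power_mult_distrib)
  \<comment> \<open>The \<open>m\<close>-th powers of \<open>z\<^sub>1 s\<close>, of \<open>\<mu> z\<^sub>2\<close> and of their counterparts in the weights \<open>b\<close>.\<close>
  define e X X' Y Y' where "e = (- 1 :: complex) ^ m" and "X = z\<^sub>1 ^ m * t"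
    and "X' = inverse z\<^sub>1 ^ m * inverse t"
    and "Y = \<mu> ^ m * z\<^sub>2 ^ m" and "Y' = \<mu> ^ m * inverse z\<^sub>2 ^ m"
  have "- det (h_mat p q lam z\<^sub>1 z\<^sub>2) = det (two_term_mat (2 * m) \<pi>
      (\<lambda>k. inverse (z\<^sub>1 * s * r ^ c k) + \<mu> * inverse (z\<^sub>2 * r))
      (\<lambda>k. z\<^sub>1 * s * r ^ Suc (c k) + \<mu> * (z\<^sub>2 * r)))"
    using det_h_mat_two_term[OF z r r_def q s inj \<pi>_lt step, of lam] m by (simp add: \<mu>_def)
  also have "\<dots> =
    ((\<Prod>k<m. inverse (z\<^sub>1 * s * r ^ (2 * k + 0)) + \<mu> * inverse (z\<^sub>2 * r))
      - e * (\<Prod>k<m. z\<^sub>1 * s * r ^ (2 * k + 1) + \<mu> * (z\<^sub>2 * r))) *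
    ((\<Prod>k<m. inverse (z\<^sub>1 * s * r ^ (2 * k + 1)) + \<mu> * inverse (z\<^sub>2 * r))
      - e * (\<Prod>k<m. z\<^sub>1 * s * r ^ (2 * k + 2) + \<mu> * (z\<^sub>2 * r)))"
    unfolding \<pi>_def det_two_cyclic_bidiagonal[OF m(2)] by (simp add: c_def e_def)
  also have "\<dots> = ((- Y' - e * X') - e * (- Y + e * X)) * ((- Y' + e * X') - e * (- Y - e * X))"
  proof -
    have neg: "(- x) ^ m = e * x ^ m" for x :: complex
      unfolding e_def by (rule power_minus)
    have r2m: "(r\<^sup>2) ^ m = 1" using r2 by (simp add: primitive_root_def)
    show ?thesis
      unfolding prod_step_two[OF r2 m(2)] neg
      by (simp add: power_mult_distrib power_inverse rm r2m X_def X'_def Y_def Y'_def t_def)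
  qed
  also have "\<dots> = Y * Y + Y' * Y' - X * X - X' * X' - 2 * e * (Y * Y' + X * X')"
  proof -
    have "e = 1 \<or> e = - 1" by (cases "even m") (simp_all add: e_def)
    then show ?thesis by (auto simp: algebra_simps)
  qed
  also have "X * X = - (z\<^sub>1 ^ q)"
  proof -
    have "X * X = z\<^sub>1 ^ q * (t * t)" by (simp add: X_def m mult_2 power_add)
    then show ?thesis by (simp add: t2)
  qed
  also have "X' * X' = - (inverse z\<^sub>1 ^ q)"
  proof -
    have "X' * X' = inverse z\<^sub>1 ^ q * inverse (t * t)"
      by (simp add: X'_def m mult_2 power_add)
    then show ?thesis by (simp add: t2)
  qed
  also have "X * X' = 1"
  proof -
    have "t \<noteq> 0" using t2 by auto
    then show ?thesis using z by (simp add: X_def X'_def power_inverse field_simps)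
  qed
  also have "Y * Y = \<mu> ^ q * z\<^sub>2 ^ q" by (simp add: Y_def m mult_2 power_add)
  also have "Y' * Y' = \<mu> ^ q * inverse z\<^sub>2 ^ q" by (simp add: Y'_def m mult_2 power_add)
  also have "Y * Y' = \<mu> ^ q"
    unfolding Y_def Y'_def m mult_2 power_add using z by (simp add: power_inverse field_simps)
  finally show ?thesis by (simp add: \<mu>_def e_def algebra_simps)
qed

theorem theorem2p7:
  fixes p :: int and q :: nat and lam :: real and z\<^sub>1 z\<^sub>2 :: complex
  assumes "coprime p (int q)" and "q \<ge> 1" and "lam > 0"
    and "cmod z\<^sub>1 = 1" and "cmod z\<^sub>2 = 1"
  shows "(even q \<longrightarrow>
      coeff (char_poly (h_mat p q lam z\<^sub>1 z\<^sub>2)) 0 =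
        - (z\<^sub>1 ^ q + z\<^sub>1 powi (- int q)
           + complex_of_real (lam / 2) ^ q * (z\<^sub>2 ^ q + z\<^sub>2 powi (- int q)))
        + (- 1) ^ (q div 2) * 2 * (1 + complex_of_real (lam / 2) ^ q))
    \<and> (odd q \<longrightarrow>
      coeff (char_poly (h_mat p q lam z\<^sub>1 z\<^sub>2)) 0 =
        - (z\<^sub>1 ^ q + z\<^sub>1 powi (- int q)
           + complex_of_real (lam / 2) ^ q * (z\<^sub>2 ^ q + z\<^sub>2 powi (- int q))))"
proof -
  let ?H = "h_mat p q lam z\<^sub>1 z\<^sub>2"
  have z: "z\<^sub>1 \<noteq> 0" "z\<^sub>2 \<noteq> 0" using assms(4,5) by auto
  have powi: "z powi (- int q) = inverse z ^ q" for z :: complex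
    by (simp add: power_int_minus power_inverse)
  have H: "?H \<in> carrier_mat q q" using h_mat_carrier[OF z] .
  have "coeff (char_poly ?H) 0 = det (- char_matrix ?H 0)"
    using char_poly_matrix[OF H, of 0] by (simp add: poly_0_coeff_0)
  also have "- char_matrix ?H 0 = (- 1) \<cdot>\<^sub>m ?H"
    using H by (intro eq_matI) (auto simp: char_matrix_def)
  also have "det \<dots> = (- 1) ^ q * det ?H" using H by simp
  finally have coeff: "coeff (char_poly ?H) 0 = (- 1) ^ q * det ?H" .
  show ?thesis
  proof (intro conjI impI)
    assume "even q"
    then obtain m where m: "q = 2 * m" by blast
    then have "m \<ge> 1" using assms(2) by simp
    then show "coeff (char_poly ?H) 0 =
        - (z\<^sub>1 ^ q + z\<^sub>1 powi (- int q)
           + complex_of_real (lam / 2) ^ q * (z\<^sub>2 ^ q + z\<^sub>2 powi (- int q)))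
        + (- 1) ^ (q div 2) * 2 * (1 + complex_of_real (lam / 2) ^ q)"
      unfolding coeff powi using det_h_mat_even[OF z assms(1) m] m by simp
  next
    assume "odd q"
    then show "coeff (char_poly ?H) 0 =
        - (z\<^sub>1 ^ q + z\<^sub>1 powi (- int q)
           + complex_of_real (lam / 2) ^ q * (z\<^sub>2 ^ q + z\<^sub>2 powi (- int q)))"
      unfolding coeff powi using det_h_mat_odd[OF z assms(1)] by simp
  qed
qed

end
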